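(* Let $\alpha=1$. Then there are no nontrivial $C^1$-solutions: if $v\in C^1$ is a tangent vector field on $\mathbb{S}^2$ and $f,p\in C^1(\mathbb{S}^2)$ are functions satisfying $$f+\operatorname{div} v=0,\qquad v\nabla f=|v|^2+f^2+2p,\qquad v\nabla v=-\nabla p$$ on $\mathbb{S}^2$, then $v=0$, $f=0$ and $p=0$ identically.
   Context: $\mathbb{S}^2$ is the unit sphere in $\mathbb{R}^3$ with its standard metric; $\nabla$, $\operatorname{div}$ and $|\cdot|$ are taken on $\mathbb{S}^2$; $v\nabla f=\langle v,\nabla f\rangle$ and $v\nabla v$ is the covariant derivative of $v$ along $v$. The displayed system is the case $\alpha=1$ of the system $$(2-\alpha)f+\operatorname{div}v=0,\quad v\nabla f=|v|^2+\alpha f^2+2\alpha p,\quad (1-\alpha)fv+v\nabla v=-\nabla p,$$ which is equivalent to the field $V(x)=(v+f\vec n)/|x|^{\alpha}$ and pressure $P(x)=p/|x|^{2\alpha}$ ($\vec n$ the outward unit normal of $\mathbb{S}^2$, and $v,f,p,\vec n$ evaluated at $x/|x|$) solving the stationary Euler equations $V\cdot\nabla V+\nabla P=0$, $\operatorname{div}V=0$ in $\mathbb{R}^3\setminus\{0\}$. A $C^1$-solution is one with $v,f,p\in C^1(\mathbb{S}^2)$. *)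

theory Defs
  imports "HOL-Analysis.Analysis"
begin

abbreviation S2 :: "(real^3) set"
  where "S2 \<equiv> sphere 0 1"

text \<open>
  Functions and vector fields on the sphere are represented by functions on \<open>real^3\<close>, of which
  only the values on \<^const>\<open>S2\<close> matter; the tangent space at \<open>x\<close> is the plane orthogonal to \<open>x\<close>.
\<close>

definition tangent_field :: "(real^3 \<Rightarrow> real^3) \<Rightarrow> bool"
  where "tangent_field v \<longleftrightarrow> (\<forall>x\<in>S2. v x \<bullet> x = 0)"

definition tan_proj :: "real^3 \<Rightarrow> real^3 \<Rightarrow> real^3"
  where "tan_proj x w = w - (w \<bullet> x) *\<^sub>R x"

text \<open>
  A derivative within the sphere is determined on the tangent plane only. The differential on the
  sphere is represented by the derivative that vanishes on the normal line.
\<close>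

definition sphere_deriv :: "(real^3 \<Rightarrow> 'b::real_normed_vector) \<Rightarrow> real^3 \<Rightarrow> real^3 \<Rightarrow> 'b"
  where "sphere_deriv F x = (THE D. (F has_derivative D) (at x within S2) \<and> D x = 0)"

lemma has_derivative_normalize:
  assumes "x \<in> S2"
  shows "((\<lambda>y. y /\<^sub>R norm y) has_derivative tan_proj x) (at x)"
proof -
  have "norm x = 1" "x \<noteq> 0" "sgn x = x" using assms by (auto simp: sgn_div_norm)
  moreover from this have "(norm has_derivative (\<lambda>w. w \<bullet> x)) (at x)"
    using has_derivative_norm[of x] by simp
  ultimately show ?thesis
    by (auto intro!: derivative_eq_intros simp: fun_eq_iff tan_proj_def)
qed

lemma has_derivative_homogeneous_extension:
  assumes x: "x \<in> S2" and F: "(F has_derivative D) (at x within S2)"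
  shows "((\<lambda>y. F (y /\<^sub>R norm y)) has_derivative (\<lambda>w. D (tan_proj x w))) (at x)"
proof -
  have nx: "norm x = 1" "x \<in> - {0}" using x by auto
  have im: "(\<lambda>y. y /\<^sub>R norm y) ` (- {0}) \<subseteq> S2" by (auto simp: field_simps split: if_splits)
  have "(F has_derivative D) (at (x /\<^sub>R norm x) within (\<lambda>y. y /\<^sub>R norm y) ` (- {0}))"
    using has_derivative_subset[OF F im] nx by simp
  from diff_chain_within[OF has_derivative_at_withinI[OF has_derivative_normalize[OF x]] this]
  have "((\<lambda>y. F (y /\<^sub>R norm y)) has_derivative (\<lambda>w. D (tan_proj x w))) (at x within - {0})"
    by (simp add: o_def)
  then show ?thesis
    using at_within_open[OF nx(2)] by (simp add: open_Compl)
qed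

lemma sphere_deriv_ex1:
  assumes x: "x \<in> S2" and F: "F differentiable (at x within S2)"
  shows "\<exists>!D. (F has_derivative D) (at x within S2) \<and> D x = 0"
proof -
  obtain D where D: "(F has_derivative D) (at x within S2)"
    using F by (auto simp: differentiable_def)
  let ?D = "\<lambda>w. D (tan_proj x w)"
  have xx: "x \<bullet> x = 1" using x by (simp add: dot_square_norm)
  show ?thesis
  proof (rule ex1I[of _ ?D])
    have "((\<lambda>y. F (y /\<^sub>R norm y)) has_derivative ?D) (at x within S2)"
      by (rule has_derivative_at_withinI[OF has_derivative_homogeneous_extension[OF x D]])
    then have "(F has_derivative ?D) (at x within S2)"
      by (rule has_derivative_transform[OF x _, rotated]) simp
    moreover have "?D x = 0"
      using linear_0[OF has_derivative_linear[OF D]] xx by (simp add: tan_proj_def)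
    ultimately show "(F has_derivative ?D) (at x within S2) \<and> ?D x = 0" ..
  next
    fix E assume E: "(F has_derivative E) (at x within S2) \<and> E x = 0"
    then have lin: "linear E" by (auto intro: has_derivative_linear)
    have "E (tan_proj x w) = E w" for w
      using E by (simp add: tan_proj_def linear_diff[OF lin] linear_cmul[OF lin])
    moreover have "(\<lambda>w. E (tan_proj x w)) = ?D"
      by (rule has_derivative_unique[OF
            has_derivative_homogeneous_extension[OF x conjunct1[OF E]]
            has_derivative_homogeneous_extension[OF x D]])
    ultimately show "E = ?D" by simp
  qed
qed

definition C1_on_sphere :: "(real^3 \<Rightarrow> 'b::real_normed_vector) \<Rightarrow> bool"
  where "C1_on_sphere F \<longleftrightarrow>
    (\<forall>x\<in>S2. F differentiable (at x within S2)) \<and>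
    (\<forall>w. continuous_on S2 (\<lambda>x. sphere_deriv F x w))"

text \<open>The Riesz representative of the differential; it is tangent since the differential
  vanishes on the normal.\<close>

definition sphere_grad :: "(real^3 \<Rightarrow> real) \<Rightarrow> real^3 \<Rightarrow> real^3"
  where "sphere_grad f x = (\<Sum>b\<in>Basis. sphere_deriv f x b *\<^sub>R b)"

text \<open>The Levi-Civita connection of the induced metric: the tangential part of the derivative
  of \<open>v\<close> at \<open>x\<close> in the tangent direction \<open>w\<close>.\<close>

definition cov_deriv :: "(real^3 \<Rightarrow> real^3) \<Rightarrow> real^3 \<Rightarrow> real^3 \<Rightarrow> real^3"
  where "cov_deriv v x w = tan_proj x (sphere_deriv v x w)"

text \<open>The trace of \<open>w \<mapsto> cov_deriv v x w\<close> on the tangent plane, computed as the trace over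
  \<open>real^3\<close> of its extension by zero along the normal.\<close>

definition sphere_div :: "(real^3 \<Rightarrow> real^3) \<Rightarrow> real^3 \<Rightarrow> real"
  where "sphere_div v x = (\<Sum>b\<in>Basis. cov_deriv v x (tan_proj x b) \<bullet> b)"

end

theory Submission
  imports Defs "HOL-Complex_Analysis.Cauchy_Integral_Formula"
begin

text \<open>
  Put \<open>H = |v|\<^sup>2 + 2 p\<close>. The momentum equation makes \<open>H\<close> constant along \<open>v\<close>, and \<open>v \<nabla>f = H + f\<^sup>2\<close>.
  A solution of this Riccati equation along a trajectory is bounded only if \<open>H + f\<^sup>2 \<le> 0\<close>; a penalised
  maximum principle gives this inequality without following trajectories. Since
  \<open>div (f v) = v \<nabla>f - f\<^sup>2 = H \<le> 0\<close> integrates to zero over the sphere, \<open>H = 0\<close> and hence \<open>f = 0\<close>.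
  What remains is \<open>div v = 0\<close> and \<open>v \<nabla>v = \<nabla>|v|\<^sup>2 / 2\<close>. In two dimensions the latter says that
  the curl of \<open>v\<close> vanishes where \<open>v \<noteq> 0\<close>, hence everywhere by continuity. In the stereographic
  coordinate such a field becomes an entire function vanishing at infinity, so it is zero
  by Liouville's theorem.
\<close>

section \<open>Differentiation on the sphere\<close>

lemma normalize_in_S2: "x \<noteq> 0 \<Longrightarrow> x /\<^sub>R norm x \<in> S2"
  by simp

lemma
  assumes "x \<in> S2" and "F differentiable (at x within S2)"
  shows has_sphere_deriv: "(F has_derivative sphere_deriv F x) (at x within S2)"
    and sphere_deriv_normal: "sphere_deriv F x x = 0"
  using theI'[OF sphere_deriv_ex1[OF assms]] unfolding sphere_deriv_def by auto

lemma sphere_deriv_eqI: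
  assumes "x \<in> S2" and "(F has_derivative D) (at x within S2)" and "D x = 0"
  shows "sphere_deriv F x = D"
  using sphere_deriv_ex1[OF assms(1), of F] assms
    has_sphere_deriv[OF assms(1), of F] sphere_deriv_normal[OF assms(1), of F]
  by (metis differentiable_def)

lemma linear_sphere_deriv:
  assumes "x \<in> S2" and "F differentiable (at x within S2)"
  shows "linear (sphere_deriv F x)"
  using has_derivative_linear[OF has_sphere_deriv[OF assms]] .

lemma sphere_deriv_tan_proj:
  assumes "x \<in> S2" and "F differentiable (at x within S2)"
  shows "sphere_deriv F x (tan_proj x w) = sphere_deriv F x w"
  using linear_sphere_deriv[OF assms] sphere_deriv_normal[OF assms]
  by (simp add: tan_proj_def linear_diff linear_cmul)

text \<open>The extension of \<open>F\<close> constant along rays is invariant under scaling, so its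
  derivative at \<open>y\<close> is the one at the point of the sphere below \<open>y\<close>,
  applied to the rescaled vector. It turns derivatives within the sphere into derivatives in
  space.\<close>

lemma has_derivative_extension:
  assumes y: "y \<noteq> 0" and F: "F differentiable (at (y /\<^sub>R norm y) within S2)"
  shows "((\<lambda>y. F (y /\<^sub>R norm y)) has_derivative
    (\<lambda>w. sphere_deriv F (y /\<^sub>R norm y) (w /\<^sub>R norm y))) (at y)"
proof -
  let ?x = "y /\<^sub>R norm y"
  have x: "?x \<in> S2" using normalize_in_S2[OF y] .
  have "((\<lambda>z. F (z /\<^sub>R norm z)) has_derivative sphere_deriv F ?x) (at ?x)"
    using has_derivative_homogeneous_extension[OF x has_sphere_deriv[OF x F]]
    by (simp add: sphere_deriv_tan_proj[OF x F])
  moreover have "((\<lambda>z. z /\<^sub>R norm y) has_derivative (\<lambda>w. w /\<^sub>R norm y)) (at y)"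
    by (auto intro!: derivative_eq_intros)
  ultimately have "((\<lambda>z. F ((z /\<^sub>R norm y) /\<^sub>R norm (z /\<^sub>R norm y))) has_derivative
      (\<lambda>w. sphere_deriv F ?x (w /\<^sub>R norm y))) (at y)"
    using has_derivative_compose[of "\<lambda>z. z /\<^sub>R norm y" "\<lambda>w. w /\<^sub>R norm y" y UNIV
        "\<lambda>z. F (z /\<^sub>R norm z)" "sphere_deriv F ?x"] by simp
  moreover have "(z /\<^sub>R norm y) /\<^sub>R norm (z /\<^sub>R norm y) = z /\<^sub>R norm z" for z :: "real^3"
    using y by (simp add: field_simps)
  ultimately show ?thesis by (simp only:)
qed

lemma has_derivative_extension_S2:
  assumes x: "x \<in> S2" and F: "F differentiable (at x within S2)"
  shows "((\<lambda>y. F (y /\<^sub>R norm y)) has_derivative sphere_deriv F x) (at x)"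
proof -
  have "x \<noteq> 0" "x /\<^sub>R norm x = x" "norm x = 1" using x by auto
  then show ?thesis using has_derivative_extension[of x F] F by simp
qed

lemma C1_on_sphere_differentiable:
  "C1_on_sphere F \<Longrightarrow> x \<in> S2 \<Longrightarrow> F differentiable (at x within S2)"
  by (simp add: C1_on_sphere_def)

lemma C1_on_sphere_has_deriv:
  "C1_on_sphere F \<Longrightarrow> x \<in> S2 \<Longrightarrow> (F has_derivative sphere_deriv F x) (at x within S2)"
  by (simp add: C1_on_sphere_def has_sphere_deriv)

lemma C1_on_sphere_deriv_normal:
  "C1_on_sphere F \<Longrightarrow> x \<in> S2 \<Longrightarrow> sphere_deriv F x x = 0"
  by (simp add: C1_on_sphere_def sphere_deriv_normal)

lemma C1_on_sphere_continuous_deriv: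
  "C1_on_sphere F \<Longrightarrow> continuous_on S2 (\<lambda>x. sphere_deriv F x w)"
  by (simp add: C1_on_sphere_def)

lemma C1_on_sphereI:
  assumes D: "\<And>x. x \<in> S2 \<Longrightarrow> (F has_derivative D x) (at x within S2)"
    and "\<And>x. x \<in> S2 \<Longrightarrow> D x x = 0"
    and cont: "\<And>w. continuous_on S2 (\<lambda>x. D x w)"
  shows "C1_on_sphere F" and "\<And>x. x \<in> S2 \<Longrightarrow> sphere_deriv F x = D x"
proof -
  show eq: "sphere_deriv F x = D x" if "x \<in> S2" for x
    using assms that by (intro sphere_deriv_eqI) auto
  have "continuous_on S2 (\<lambda>x. sphere_deriv F x w)" for w
    by (rule continuous_on_eq[OF cont]) (simp add: eq)
  then show "C1_on_sphere F"
    using D unfolding C1_on_sphere_def differentiable_def by blast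
qed

lemma C1_on_sphere_continuous: "C1_on_sphere F \<Longrightarrow> continuous_on S2 F"
  by (meson C1_on_sphere_differentiable continuous_on_eq_continuous_within
      differentiable_imp_continuous_within)

lemma linear_expand:
  fixes L :: "'a::euclidean_space \<Rightarrow> 'b::real_vector"
  assumes "linear L"
  shows "L w = (\<Sum>b\<in>Basis. (w \<bullet> b) *\<^sub>R L b)"
proof -
  have "L w = L (\<Sum>b\<in>Basis. (w \<bullet> b) *\<^sub>R b)" by (simp add: euclidean_representation)
  also have "\<dots> = (\<Sum>b\<in>Basis. (w \<bullet> b) *\<^sub>R L b)"
    by (simp add: linear_sum[OF assms] linear_cmul[OF assms])
  finally show ?thesis .
qed

text \<open>\<open>C1_on_sphere\<close> speaks of fixed directions only; expanding in the finite
  basis makes the differential jointly continuous in point and direction.\<close>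

lemma continuous_on_sphere_deriv:
  assumes F: "C1_on_sphere F" and g: "continuous_on S g" "g ` S \<subseteq> S2"
    and W: "continuous_on S W"
  shows "continuous_on S (\<lambda>s. sphere_deriv F (g s) (W s))"
proof -
  have "continuous_on S (\<lambda>s. sphere_deriv F (g s) b)" for b
    using continuous_on_compose2[OF _ g] F by (auto simp: C1_on_sphere_def)
  then have "continuous_on S (\<lambda>s. \<Sum>b\<in>Basis. (W s \<bullet> b) *\<^sub>R sphere_deriv F (g s) b)"
    by (intro continuous_intros W)
  moreover have "sphere_deriv F (g s) (W s) = (\<Sum>b\<in>Basis. (W s \<bullet> b) *\<^sub>R sphere_deriv F (g s) b)"
    if "s \<in> S" for s
    using that g(2) C1_on_sphere_differentiable[OF F]
    by (intro linear_expand linear_sphere_deriv) auto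
  ultimately show ?thesis by (simp cong: continuous_on_cong)
qed

lemma inner_sphere_grad:
  assumes "x \<in> S2" and "f differentiable (at x within S2)"
  shows "w \<bullet> sphere_grad f x = sphere_deriv f x w"
  using linear_expand[OF linear_sphere_deriv[OF assms], of w]
  by (simp add: sphere_grad_def inner_sum_right inner_scaleR_right algebra_simps)

text \<open>The projections in \<open>sphere_div\<close> subtract only
  \<open>sphere_deriv v x x \<bullet> x\<close>, which is zero because the differential vanishes on
  the normal.\<close>

lemma sphere_div_eq_trace:
  assumes x: "x \<in> S2" and v: "v differentiable (at x within S2)"
  shows "sphere_div v x = (\<Sum>b\<in>Basis. sphere_deriv v x b \<bullet> b)"
proof -
  let ?D = "sphere_deriv v x"
  have "sphere_div v x = (\<Sum>b\<in>Basis. ?D b \<bullet> b) - (\<Sum>b\<in>Basis. (x \<bullet> b) *\<^sub>R ?D b) \<bullet> x"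
    by (simp add: sphere_div_def cov_deriv_def sphere_deriv_tan_proj[OF x v]
        tan_proj_def[of x "?D _"] inner_diff_left sum_subtractf inner_sum_left mult.commute)
  then show ?thesis
    using linear_expand[OF linear_sphere_deriv[OF x v], of x] sphere_deriv_normal[OF x v]
    by simp
qed

section \<open>The divergence theorem\<close>

text \<open>Squaring smooths the corner of the positive part at 0; this supplies the continuously
  differentiable cutoff of the divergence theorem.\<close>

lemma DERIV_square_pos_part:
  "((\<lambda>t::real. (max 0 t)\<^sup>2) has_real_derivative 2 * max 0 t) (at t)"
proof -
  consider "t > 0" | "t < 0" | "t = 0" by linarith
  then show ?thesis
  proof cases
    case 1
    have "((\<lambda>t::real. t\<^sup>2) has_real_derivative 2 * max 0 t) (at t)"
      using 1 by (auto intro!: derivative_eq_intros)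
    then show ?thesis
      by (rule has_field_derivative_transform_within_open[of _ _ _ "{0<..}"]) (use 1 in auto)
  next
    case 2
    have "((\<lambda>t::real. 0) has_real_derivative 2 * max 0 t) (at t)"
      using 2 by auto
    then show ?thesis
      by (rule has_field_derivative_transform_within_open[of _ _ _ "{..<0}"]) (use 2 in auto)
  next
    case 3
    have "((\<lambda>h::real. (max 0 h)\<^sup>2 / h) \<longlongrightarrow> 0) (at 0)"
    proof (rule Lim_null_comparison)
      show "\<forall>\<^sub>F h in at 0. norm ((max 0 h)\<^sup>2 / h) \<le> \<bar>h\<bar>"
        by (auto simp: max_def power2_eq_square)
    qed (auto intro!: tendsto_eq_intros)
    then show ?thesis using 3 by (simp add: DERIV_def)
  qed
qed

text \<open>The integral of \<open>h (x + t *\<^sub>R e)\<close> does not depend on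
  \<open>t\<close>; differentiating under the integral at \<open>t = 0\<close> gives the
  claim.\<close>

lemma integral_derivative_compact_support:
  fixes h :: "'a::euclidean_space \<Rightarrow> real"
  assumes h: "\<And>x. (h has_derivative h' x) (at x)"
    and cont: "continuous_on UNIV (\<lambda>x. h' x e)"
    and supp: "\<And>x. x \<notin> cbox a b \<Longrightarrow> h x = 0"
  shows "((\<lambda>x. h' x e) has_integral 0) (cbox a b)"
proof -
  have hc: "continuous_on S h" for S
    using has_derivative_continuous[OF h] by (auto intro!: continuous_at_imp_continuous_on)
  \<comment> \<open>The supports of all translates with \<open>t\<close> between -1 and 1 lie in
    this compact set, so one fixed box serves as domain of integration.\<close>
  let ?S = "(\<lambda>(x, t). x - t *\<^sub>R e) ` (cbox a b \<times> {-1..1::real})"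
  have "compact ?S"
    by (intro compact_continuous_image compact_Times)
       (auto intro!: continuous_intros simp: split_beta)
  then obtain c where c: "?S \<subseteq> cbox (-c) c"
    using bounded_subset_cbox_symmetric compact_imp_bounded by metis
  have sub: "x \<in> cbox (-c) c" if "x + t *\<^sub>R e \<in> cbox a b" "t \<in> {-1..1}" for x t
    using c that by (force simp: image_subset_iff)
  let ?I = "integral (cbox a b) h"
  have shift: "((\<lambda>x. h (x + t *\<^sub>R e)) has_integral ?I) (cbox (-c) c)" if t: "t \<in> {-1..1}" for t
  proof -
    have "(h has_integral ?I) (cbox a b)"
      using integrable_continuous hc by blast
    from has_integral_affinity'[OF this, of 1 "t *\<^sub>R e"]
    have "((\<lambda>x. h (x + t *\<^sub>R e)) has_integral ?I) (cbox (a - t *\<^sub>R e) (b - t *\<^sub>R e))"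
      by simp
    moreover have "x \<in> cbox (a - t *\<^sub>R e) (b - t *\<^sub>R e) \<longleftrightarrow> x + t *\<^sub>R e \<in> cbox a b" for x
      by (auto simp: mem_box algebra_simps)
    ultimately show ?thesis
      using supp sub[OF _ t] by (intro has_integral_on_superset[where T = "cbox (-c) c"]) blast+
  qed
  have "((\<lambda>t. integral (cbox (-c) c) (\<lambda>x. h (x + t *\<^sub>R e))) has_vector_derivative
      integral (cbox (-c) c) (\<lambda>x. h' (x + 0 *\<^sub>R e) e)) (at 0 within {-1..1})"
  proof (rule leibniz_rule_vector_derivative)
    fix t :: real and x
    have "((\<lambda>t. h (x + t *\<^sub>R e)) has_derivative (\<lambda>s. h' (x + t *\<^sub>R e) (s *\<^sub>R e))) (at t within {-1..1})"
      by (rule has_derivative_compose[OF _ h]) (auto intro!: derivative_eq_intros)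
    then show "((\<lambda>t. h (x + t *\<^sub>R e)) has_vector_derivative h' (x + t *\<^sub>R e) e) (at t within {-1..1})"
      by (simp add: has_vector_derivative_def linear_cmul[OF has_derivative_linear[OF h]])
  next
    show "continuous_on ({-1..1} \<times> cbox (-c) c) (\<lambda>(t, x). h' (x + t *\<^sub>R e) e)"
      unfolding split_beta
      by (rule continuous_on_compose2[OF cont]) (auto intro!: continuous_intros)
  qed (use shift in auto)
  moreover have "((\<lambda>t. integral (cbox (-c) c) (\<lambda>x. h (x + t *\<^sub>R e))) has_vector_derivative 0)
      (at 0 within {-1..1})"
    by (rule has_vector_derivative_transform[of _ _ _ "\<lambda>t. ?I"])
       (use shift in \<open>auto simp: integral_unique\<close>)
  ultimately have "integral (cbox (-c) c) (\<lambda>x. h' (x + 0 *\<^sub>R e) e) = 0"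
    by (rule vector_derivative_unique_within[rotated]) (simp add: at_within_Icc_at)
  then have "integral (cbox (-c) c) (\<lambda>x. h' x e) = 0" by simp
  moreover have "(\<lambda>x. h' x e) integrable_on cbox (-c) c"
    using integrable_continuous continuous_on_subset[OF cont] by blast
  ultimately have I: "((\<lambda>x. h' x e) has_integral 0) (cbox (-c) c)"
    by (metis integrable_integral)
  \<comment> \<open>Outside the small box, an open set, \<open>h\<close> is identically zero, so the
    integrals over both boxes agree.\<close>
  have "h' x e = 0" if "x \<notin> cbox a b" for x
  proof -
    have "(h has_derivative (\<lambda>_. 0)) (at x)"
      using has_derivative_const[of "0::real"]
      by (rule has_derivative_transform_within_open[of _ _ _ _ "- cbox a b"])
         (use that supp in \<open>auto simp: closed_cbox open_Compl\<close>)
    then show ?thesis using has_derivative_unique[OF h] by metis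
  qed
  then have "(\<lambda>x. h' x e) = (\<lambda>x. if x \<in> cbox a b then h' x e else 0)" by auto
  then show ?thesis
    using I has_integral_restrict[of "cbox a b" "cbox (-c) c" "\<lambda>x. h' x e" 0] sub[of _ 0]
    by (metis (lifting) add.right_neutral atLeastAtMost_iff neg_le_0_iff_le scale_zero_left subsetI zero_le_one)
qed

text \<open>The total divergence of a tangent field is zero, so a continuous divergence of one sign
  vanishes. The integration runs over the shell between the radii 1 and 2 in space instead of over
  the sphere.\<close>

lemma sphere_div_nonpos_imp_zero:
  assumes tan: "tangent_field u" and u: "C1_on_sphere u"
    and nonpos: "\<And>x. x \<in> S2 \<Longrightarrow> sphere_div u x \<le> 0"
    and z: "z \<in> S2"
  shows "sphere_div u z = 0"
proof -
  \<comment> \<open>\<open>U\<close> extends \<open>u\<close> to a compactly supported \<open>C\<^sup>1\<close> field on \<open>real^3\<close>; the cutoff \<open>m\<^sup>2\<close> is radial,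
    so its gradient is orthogonal to \<open>U\<close> and only a multiple of \<open>sphere_div u\<close> is left of the divergence.\<close>
  define m where "m x = max 0 ((x \<bullet> x - 1) * (4 - x \<bullet> x))" for x :: "real^3"
  \<comment> \<open>\<open>dm x * (x \<bullet> w)\<close> is to be the derivative of
    \<open>(m x)\<^sup>2\<close> in the direction \<open>w\<close>.\<close>
  define dm where "dm x = 2 * m x * (2 * (5 - 2 * (x \<bullet> x)))" for x :: "real^3"
  define G where "G x = u (x /\<^sub>R norm x)" for x
  define U where "U x = (m x)\<^sup>2 *\<^sub>R G x" for x
  define DU where "DU x w = (dm x * (x \<bullet> w)) *\<^sub>R G x +
    (m x)\<^sup>2 *\<^sub>R sphere_deriv u (x /\<^sub>R norm x) (w /\<^sub>R norm x)" for x w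
  have m0: "m x = 0" if "norm x \<le> 1 \<or> norm x \<ge> 2" for x
  proof -
    have "x \<bullet> x \<le> 1 \<or> x \<bullet> x \<ge> 4"
      using that power_mono[of "norm x" 1 2] power_mono[of 2 "norm x" 2]
      by (auto simp: dot_square_norm)
    then have "(x \<bullet> x - 1) * (4 - x \<bullet> x) \<le> 0"
      by (auto simp: mult_le_0_iff)
    then show ?thesis by (simp add: m_def)
  qed
  have dU: "(U has_derivative DU x) (at x)" for x
  \<comment> \<open>\<open>G\<close> may be singular at the origin, but \<open>m\<close> vanishes on
    the unit ball. In \<open>DU\<close> at 0 the unspecified value \<open>sphere_deriv u 0\<close>
    is multiplied by zero.\<close>
  proof (cases "x = 0")
    case True
    have "(U has_derivative (\<lambda>_. 0)) (at x)"
      using has_derivative_const[of "0::real^3"]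
      by (rule has_derivative_transform_within_open[of _ _ _ _ "ball 0 1"])
         (use True in \<open>auto simp: U_def m0\<close>)
    moreover have "DU x = (\<lambda>_. 0)"
      using True by (auto simp: DU_def dm_def m0)
    ultimately show ?thesis by simp
  next
    case False
    have q: "((\<lambda>x::real^3. (x \<bullet> x - 1) * (4 - x \<bullet> x)) has_derivative
        (\<lambda>w. 2 * (5 - 2 * (x \<bullet> x)) * (x \<bullet> w))) (at x)"
      by (auto intro!: derivative_eq_intros simp: fun_eq_iff algebra_simps inner_commute)
    have "((\<lambda>x. (m x)\<^sup>2) has_derivative (\<lambda>w. dm x * (x \<bullet> w))) (at x)"
      using has_derivative_compose[OF q DERIV_square_pos_part[unfolded has_field_derivative_def]]
      unfolding m_def[symmetric] dm_def mult.assoc by simp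
    moreover have "(G has_derivative (\<lambda>w. sphere_deriv u (x /\<^sub>R norm x) (w /\<^sub>R norm x))) (at x)"
      unfolding G_def
      by (intro has_derivative_extension False C1_on_sphere_differentiable[OF u] normalize_in_S2)
    ultimately show ?thesis
      unfolding U_def DU_def
      by (rule has_derivative_eq_rhs[OF has_derivative_scaleR]) (simp add: add.commute)
  qed
  have cDU: "continuous_on UNIV (\<lambda>x. DU x b)" for b
  proof -
    have n: "continuous_on (-{0}) (\<lambda>x::real^3. x /\<^sub>R norm x)"
      by (intro continuous_intros) auto
    have S2: "(\<lambda>x::real^3. x /\<^sub>R norm x) ` (-{0}) \<subseteq> S2"
      using normalize_in_S2 by blast
    have "continuous_on (-{0}) G"
      unfolding G_def by (rule continuous_on_compose2[OF C1_on_sphere_continuous[OF u] n S2])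
    moreover have "continuous_on (-{0}) (\<lambda>x. sphere_deriv u (x /\<^sub>R norm x) (b /\<^sub>R norm x))"
      by (rule continuous_on_sphere_deriv[OF u n S2]) (intro continuous_intros, auto)
    ultimately have "continuous_on (-{0}) (\<lambda>x. DU x b)"
      unfolding DU_def dm_def m_def by (intro continuous_intros)
    moreover have "continuous_on (ball 0 1) (\<lambda>x. DU x b)"
      by (rule continuous_on_eq[OF continuous_on_const[of _ 0]]) (auto simp: DU_def dm_def m0)
    ultimately have "continuous_on (-{0} \<union> ball 0 1) (\<lambda>x. DU x b)"
      by (intro continuous_on_open_Un) (auto simp: open_Compl)
    moreover have "-{0} \<union> ball 0 1 = (UNIV :: (real^3) set)" by auto
    ultimately show ?thesis by simp
  qed
  \<comment> \<open>The cube of half-side 2 contains the ball of radius 2, outside which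
    \<open>m\<close> vanishes.\<close>
  define c :: "real^3" where "c = (\<Sum>b\<in>Basis. 2 *\<^sub>R b)"
  have cb: "c \<bullet> b = 2" if "b \<in> Basis" for b
    using that by (simp add: c_def inner_sum_left inner_Basis if_distrib cong: if_cong)
  have supp: "m x = 0" if x: "x \<notin> cbox (-c) c" for x
  proof -
    obtain b where b: "b \<in> Basis" "\<not> (- (c \<bullet> b) \<le> x \<bullet> b \<and> x \<bullet> b \<le> c \<bullet> b)"
      using x unfolding mem_box inner_minus_left by blast
    then have "2 < \<bar>x \<bullet> b\<bar>" using cb by auto
    then show ?thesis
      using Basis_le_norm[OF b(1), of x] by (intro m0) auto
  qed
  have U0: "U x = 0" if "x \<notin> cbox (-c) c" for x using supp[OF that] by (simp add: U_def)
  have "((\<lambda>x. DU x b \<bullet> b) has_integral 0) (cbox (-c) c)" for b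
    by (rule integral_derivative_compact_support
          [where h = "\<lambda>x. U x \<bullet> b" and h' = "\<lambda>x w. DU x w \<bullet> b"])
       (auto intro!: has_derivative_inner_left dU continuous_intros cDU simp: U0)
  then have "((\<lambda>x. \<Sum>b\<in>Basis. DU x b \<bullet> b) has_integral (\<Sum>b\<in>(Basis::(real^3) set). 0)) (cbox (-c) c)"
    by (intro has_integral_sum finite_Basis)
  from has_integral_neg[OF this] have I: "((\<lambda>x. - (\<Sum>b\<in>Basis. DU x b \<bullet> b)) has_integral 0) (cbox (-c) c)"
    by simp
  have div: "(\<Sum>b\<in>Basis. DU x b \<bullet> b) = (m x)\<^sup>2 / norm x * sphere_div u (x /\<^sub>R norm x)"
    if "x \<noteq> 0" for x
  proof -
    let ?y = "x /\<^sub>R norm x"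
    have y: "?y \<in> S2" using normalize_in_S2[OF that] .
    note d = C1_on_sphere_differentiable[OF u y]
    have "u ?y \<bullet> ?y = 0" using tan y unfolding tangent_field_def by blast
    then have "x \<bullet> G x = 0" using that by (simp add: G_def inner_commute)
    moreover have "(\<Sum>b\<in>Basis. (x \<bullet> b) * (G x \<bullet> b)) = x \<bullet> G x"
      by (rule euclidean_inner[symmetric])
    ultimately show ?thesis
      by (simp add: DU_def inner_add_left sum.distrib sphere_div_eq_trace[OF y d] mult.assoc
          linear_cmul[OF linear_sphere_deriv[OF y d]] flip: sum_distrib_left)
         (simp add: divide_inverse)
  qed
  have nn: "0 \<le> - (\<Sum>b\<in>Basis. DU x b \<bullet> b)" for x
  proof (cases "x = 0")
    case True
    then show ?thesis by (simp add: DU_def dm_def m0)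
  next
    case False
    then show ?thesis
      using nonpos[OF normalize_in_S2[OF False]] by (simp add: div mult_nonneg_nonpos divide_nonpos_nonneg)
  qed
  \<comment> \<open>Radius 3/2 lies inside the shell, where \<open>m\<close> is positive and the
    integrand is a positive multiple of \<open>- sphere_div u z\<close>.\<close>
  let ?x = "(3/2) *\<^sub>R z"
  have nz: "norm z = 1" using z by simp
  have "- (\<Sum>b\<in>Basis. DU ?x b \<bullet> b) = 0"
  proof (rule has_integral_0_cbox_imp_0[OF _ nn I])
    show "continuous_on (cbox (-c) c) (\<lambda>x. - (\<Sum>b\<in>Basis. DU x b \<bullet> b))"
      by (intro continuous_intros continuous_on_subset[OF cDU]) auto
    show "box (-c) c \<noteq> {}" by (simp add: box_ne_empty cb)
    show "?x \<in> cbox (-c) c"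
      unfolding mem_box
    proof
      fix b :: "real^3" assume b: "b \<in> Basis"
      then have "\<bar>z \<bullet> b\<bar> \<le> 1" using Basis_le_norm[of b z] nz by simp
      then show "- c \<bullet> b \<le> ?x \<bullet> b \<and> ?x \<bullet> b \<le> c \<bullet> b"
        by (simp add: cb[OF b]) linarith
    qed
  qed
  moreover have "m ?x \<noteq> 0" using nz by (simp add: m_def dot_square_norm power2_eq_square)
  moreover have "?x \<noteq> 0" "?x /\<^sub>R norm ?x = z" using nz by auto
  ultimately show ?thesis using div[of ?x] nz by simp
qed

section \<open>Product rules on the sphere\<close>

lemma
  fixes f :: "real^3 \<Rightarrow> real" and v :: "real^3 \<Rightarrow> 'b::real_normed_vector"
  assumes f: "C1_on_sphere f" and v: "C1_on_sphere v"
  shows C1_on_sphere_scaleR: "C1_on_sphere (\<lambda>y. f y *\<^sub>R v y)"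
    and sphere_deriv_scaleR: "\<And>x. x \<in> S2 \<Longrightarrow> sphere_deriv (\<lambda>y. f y *\<^sub>R v y) x =
      (\<lambda>w. f x *\<^sub>R sphere_deriv v x w + sphere_deriv f x w *\<^sub>R v x)"
proof -
  have D: "((\<lambda>y. f y *\<^sub>R v y) has_derivative
      (\<lambda>w. f x *\<^sub>R sphere_deriv v x w + sphere_deriv f x w *\<^sub>R v x)) (at x within S2)"
    if "x \<in> S2" for x
    using that by (intro has_derivative_scaleR C1_on_sphere_has_deriv f v)
  have N: "f x *\<^sub>R sphere_deriv v x x + sphere_deriv f x x *\<^sub>R v x = 0" if "x \<in> S2" for x
    using that by (simp add: C1_on_sphere_deriv_normal f v)
  have C: "continuous_on S2 (\<lambda>x. f x *\<^sub>R sphere_deriv v x w + sphere_deriv f x w *\<^sub>R v x)" for w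
    by (intro continuous_intros C1_on_sphere_continuous C1_on_sphere_continuous_deriv f v)
  show "C1_on_sphere (\<lambda>y. f y *\<^sub>R v y)" by (rule C1_on_sphereI(1)[OF D N C])
  show "sphere_deriv (\<lambda>y. f y *\<^sub>R v y) x =
      (\<lambda>w. f x *\<^sub>R sphere_deriv v x w + sphere_deriv f x w *\<^sub>R v x)" if "x \<in> S2" for x
    by (rule C1_on_sphereI(2)[OF D N C that])
qed

lemma sphere_div_scaleR:
  assumes x: "x \<in> S2" and f: "C1_on_sphere f" and v: "C1_on_sphere v"
  shows "sphere_div (\<lambda>y. f y *\<^sub>R v y) x = f x * sphere_div v x + v x \<bullet> sphere_grad f x"
proof -
  note d = C1_on_sphere_differentiable[OF _ x]
  have "(\<Sum>b\<in>Basis. sphere_deriv f x b * (v x \<bullet> b)) = sphere_deriv f x (v x)"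
    by (simp add: linear_expand[OF linear_sphere_deriv[OF x d[OF f]], of "v x"] mult.commute)
  then show ?thesis
    by (simp add: sphere_div_eq_trace[OF x d] f v inner_sphere_grad[OF x d]
        sphere_div_eq_trace[OF x d[OF C1_on_sphere_scaleR[OF f v]]]
        sphere_deriv_scaleR[OF f v x] inner_add_left sum.distrib sum_distrib_left)
qed

section \<open>The maximum principle\<close>

text \<open>The extension is constant along rays, so an extremum over the sphere is an extremum over
  the open set of nonzero vectors.\<close>

lemma sphere_deriv_eq_0_at_extremum:
  fixes F :: "real^3 \<Rightarrow> real"
  assumes x: "x \<in> S2" and F: "F differentiable (at x within S2)"
    and ext: "(\<forall>y\<in>S2. F y \<le> F x) \<or> (\<forall>y\<in>S2. F x \<le> F y)"
  shows "sphere_deriv F x w = 0"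
proof -
  have xx: "x /\<^sub>R norm x = x" using x by simp
  have S: "y /\<^sub>R norm y \<in> S2" if "y \<in> -{0}" for y :: "real^3"
    using that normalize_in_S2 by simp
  have "(\<forall>y\<in>-{0}. F (y /\<^sub>R norm y) \<le> F (x /\<^sub>R norm x)) \<or>
      (\<forall>y\<in>-{0}. F (x /\<^sub>R norm x) \<le> F (y /\<^sub>R norm y))"
    using ext S unfolding xx by blast
  then have "sphere_deriv F x = (\<lambda>_. 0)"
    by (rule differential_zero_maxmin[OF _ _ has_derivative_extension_S2[OF x F], of "-{0}", rotated 2])
       (use x in \<open>auto simp: open_Compl\<close>)
  then show ?thesis by simp
qed

text \<open>A maximum of \<open>f\<close> penalised by the deviation of \<open>H\<close> from
  \<open>H x\<close> stands in for a limit point of a trajectory: \<open>W\<close> annihilates the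
  penalty along with \<open>H\<close>, hence also \<open>f\<close> at the maximum.\<close>

lemma exists_critical_point:
  fixes f H :: "real^3 \<Rightarrow> real"
  assumes f: "C1_on_sphere f" and H: "C1_on_sphere H" and x: "x \<in> S2" and e: "e > 0"
    and W: "\<And>y. y \<in> S2 \<Longrightarrow> sphere_deriv H y (W y) = 0"
  obtains y where "y \<in> S2" "sphere_deriv f y (W y) = 0" "f y \<ge> f x" "\<bar>H y - H x\<bar> < e"
proof -
  note cf = C1_on_sphere_continuous[OF f] and cH = C1_on_sphere_continuous[OF H]
  have "bounded (f ` S2)"
    by (intro compact_imp_bounded compact_continuous_image cf) auto
  then obtain M where M: "M > 0" "\<And>y. y \<in> S2 \<Longrightarrow> \<bar>f y\<bar> \<le> M"
    by (auto simp: bounded_pos)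
  \<comment> \<open>For this weight, maximising \<open>f - l (H - H x)\<^sup>2\<close> keeps \<open>H\<close> within \<open>e\<close> of \<open>H x\<close>.\<close>
  define l where "l = 3 * M / e\<^sup>2"
  define F where "F y = f y - l * (H y - H x)\<^sup>2" for y
  have "continuous_on S2 F"
    unfolding F_def by (intro continuous_intros cf cH)
  then obtain y where y: "y \<in> S2" "\<And>z. z \<in> S2 \<Longrightarrow> F z \<le> F y"
    using continuous_attains_sup[of S2 F] x by auto
  have l: "l > 0" using M e by (simp add: l_def)
  have *: "l * (H y - H x)\<^sup>2 \<le> f y - f x"
    using y(2)[OF x] by (simp add: F_def)
  note df = C1_on_sphere_differentiable[OF f y(1)] and dH = C1_on_sphere_differentiable[OF H y(1)]
  have D: "(F has_derivative (\<lambda>w. sphere_deriv f y w - l * (2 * (H y - H x) * sphere_deriv H y w)))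
      (at y within S2)"
    unfolding F_def using has_sphere_deriv[OF y(1) df] has_sphere_deriv[OF y(1) dH]
    by (auto intro!: derivative_eq_intros)
  then have "sphere_deriv F y (W y) = sphere_deriv f y (W y)"
    using sphere_deriv_eqI[OF y(1) D] W[OF y(1)] sphere_deriv_normal[OF y(1) df]
      sphere_deriv_normal[OF y(1) dH] by simp
  then have 1: "sphere_deriv f y (W y) = 0"
    using sphere_deriv_eq_0_at_extremum[OF y(1), of F "W y"] y(2) D by (auto simp: differentiable_def)
  \<comment> \<open>The oscillation of \<open>f\<close> is at most \<open>2 * M\<close>; the factor
    3 in \<open>l\<close> makes the inequality strict.\<close>
  have "l * (H y - H x)\<^sup>2 < 3 * M" using * M(2)[OF x] M(2)[OF y(1)] M(1) by linarith
  also have "3 * M = l * e\<^sup>2" using e by (simp add: l_def)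
  finally have "(H y - H x)\<^sup>2 < e\<^sup>2" using l by simp
  then have 2: "\<bar>H y - H x\<bar> < e" using e using power2_less_imp_less[of "\<bar>H y - H x\<bar>" e] by simp
  have "0 \<le> l * (H y - H x)\<^sup>2" using l by simp
  then have "f y \<ge> f x" using * by linarith
  then show thesis using that y(1) 1 2 by blast
qed

text \<open>At a point where the derivative of \<open>f\<close> along \<open>W\<close> vanishes,
  \<open>H + f\<^sup>2\<close> is zero. If it were positive at \<open>x\<close>, the previous lemma
  would give such a point with \<open>f\<^sup>2\<close> no smaller and \<open>H\<close> lowered by
  less than the value at \<open>x\<close>.\<close>

lemma transport_nonpos:
  fixes f H :: "real^3 \<Rightarrow> real"
  assumes f: "C1_on_sphere f" and H: "C1_on_sphere H" and x: "x \<in> S2"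
    and WH: "\<And>y. y \<in> S2 \<Longrightarrow> sphere_deriv H y (W y) = 0"
    and Wf: "\<And>y. y \<in> S2 \<Longrightarrow> sphere_deriv f y (W y) = H y + (f y)\<^sup>2"
  shows "H x + (f x)\<^sup>2 \<le> 0"
proof (rule ccontr)
  assume "\<not> ?thesis"
  then have e: "H x + (f x)\<^sup>2 > 0" by simp
  \<comment> \<open>With this sign \<open>s * f x\<close> is the absolute value of
    \<open>f x\<close>, so \<open>s * f y \<ge> s * f x\<close> compares the squares.\<close>
  define s :: real where "s = (if f x \<ge> 0 then 1 else -1)"
  have s0: "C1_on_sphere (\<lambda>_. s)" "y \<in> S2 \<Longrightarrow> sphere_deriv (\<lambda>_. s) y = (\<lambda>_. 0)" for y
    using C1_on_sphereI[of "\<lambda>_. s" "\<lambda>_ _. 0"] by auto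
  have "C1_on_sphere (\<lambda>x. s * f x)"
    and "\<forall>y\<in>S2. sphere_deriv (\<lambda>x. s * f x) y (W y) = s * sphere_deriv f y (W y)"
    using C1_on_sphere_scaleR[OF s0(1) f] sphere_deriv_scaleR[OF s0(1) f] s0(2) by auto
  then obtain y where y: "y \<in> S2" "s * sphere_deriv f y (W y) = 0" "s * f y \<ge> s * f x"
      "\<bar>H y - H x\<bar> < H x + (f x)\<^sup>2"
    using exists_critical_point[of "\<lambda>x. s * f x" H x "H x + (f x)\<^sup>2" W] H x e WH by metis
  have "(s * f x)\<^sup>2 \<le> (s * f y)\<^sup>2"
    using y(3) by (intro power_mono) (auto simp: s_def)
  then have "(f x)\<^sup>2 \<le> (f y)\<^sup>2" by (simp add: s_def split: if_splits)
  moreover have "H y + (f y)\<^sup>2 = 0" using y(1,2) Wf by (auto simp: s_def split: if_splits)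
  ultimately show False using y(4) by linarith
qed

section \<open>Harmonic fields in the stereographic coordinate\<close>

text \<open>The inverse stereographic projection from the pole \<open>(0, 0, 1)\<close>, which it omits, and its first and
  second partial derivatives.\<close>

definition stereo_q :: "complex \<Rightarrow> real"
  where "stereo_q z = inverse (1 + (Re z)\<^sup>2 + (Im z)\<^sup>2)"

definition stereo :: "complex \<Rightarrow> real^3"
  where "stereo z = vector [2 * Re z * stereo_q z, 2 * Im z * stereo_q z, 1 - 2 * stereo_q z]"

definition stereo_x :: "complex \<Rightarrow> real^3"
  where "stereo_x z = (let x = Re z; y = Im z; q = stereo_q z in
    vector [2*q - 4*x^2*q^2, - 4*x*y*q^2, 4*x*q^2])"

definition stereo_y :: "complex \<Rightarrow> real^3"
  where "stereo_y z = (let x = Re z; y = Im z; q = stereo_q z in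
    vector [- 4*x*y*q^2, 2*q - 4*y^2*q^2, 4*y*q^2])"

definition stereo_xx :: "complex \<Rightarrow> real^3"
  where "stereo_xx z = (let x = Re z; y = Im z; q = stereo_q z in
    vector [- 12*x*q^2 + 16*x^3*q^3, - 4*y*q^2 + 16*x^2*y*q^3, 4*q^2 - 16*x^2*q^3])"

definition stereo_xy :: "complex \<Rightarrow> real^3"
  where "stereo_xy z = (let x = Re z; y = Im z; q = stereo_q z in
    vector [- 4*y*q^2 + 16*x^2*y*q^3, - 4*x*q^2 + 16*x*y^2*q^3, - 16*x*y*q^3])"

definition stereo_yy :: "complex \<Rightarrow> real^3"
  where "stereo_yy z = (let x = Re z; y = Im z; q = stereo_q z in
    vector [- 4*x*q^2 + 16*x*y^2*q^3, - 12*y*q^2 + 16*y^3*q^3, 4*q^2 - 16*y^2*q^3])"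

lemmas stereo_defs = stereo_def stereo_x_def stereo_y_def stereo_xx_def stereo_xy_def stereo_yy_def

lemma stereo_q_pos: "stereo_q z > 0"
  unfolding stereo_q_def by (simp add: add_pos_nonneg)

text \<open>The identities for the coordinate frame below are polynomial consequences of this one
  relation.\<close>

lemma stereo_q_eq: "stereo_q z * (1 + (Re z)\<^sup>2 + (Im z)\<^sup>2) = 1"
  using stereo_q_pos[of z] unfolding stereo_q_def by (intro left_inverse) auto

lemma inner_vec3: "x \<bullet> y = x$1 * y$1 + x$2 * y$2 + x$3 * y$3" for x y :: "real^3"
  by (simp add: inner_vec_def sum_3)

lemma stereo_in_S2: "stereo z \<in> S2"
proof -
  have "stereo z \<bullet> stereo z = 1"
    using stereo_q_eq[of z] unfolding inner_vec3 stereo_def vector_3 by algebra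
  then show ?thesis by (simp add: norm_eq_1)
qed

text \<open>The chart is conformal: \<open>stereo_x\<close> and \<open>stereo_y\<close> are
  orthogonal tangent vectors of length \<open>2 * stereo_q z\<close>. This is the expansion of the
  tangential part of \<open>w\<close> in that frame.\<close>

lemma stereo_frame:
  "(w \<bullet> stereo_x z) *\<^sub>R stereo_x z + (w \<bullet> stereo_y z) *\<^sub>R stereo_y z =
    (4 * (stereo_q z)\<^sup>2) *\<^sub>R tan_proj (stereo z) w"
  unfolding vec_eq_iff forall_3 stereo_defs Let_def tan_proj_def inner_vec3
    vector_add_component vector_minus_component vector_scaleR_component real_scaleR_def vector_3
  by (intro conjI; use stereo_q_eq[of z] in algebra)

text \<open>The coordinate functions are eigenfunctions of the Laplacian of the sphere with
  eigenvalue -2, and the metric in this chart is \<open>4 * (stereo_q z)\<^sup>2\<close> times the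
  flat one. The flat Laplacian of the chart is therefore normal to the sphere.\<close>

lemma stereo_laplacian:
  "stereo_xx z + stereo_yy z = (- 8 * (stereo_q z)\<^sup>2) *\<^sub>R stereo z"
  unfolding vec_eq_iff forall_3 stereo_defs Let_def
    vector_add_component vector_scaleR_component real_scaleR_def vector_3
  by (intro conjI; use stereo_q_eq[of z] in algebra)

lemma stereo_x_inner:
  "stereo_x z \<bullet> stereo z = 0" "stereo_x z \<bullet> stereo_x z = 4 * (stereo_q z)\<^sup>2"
  unfolding stereo_defs Let_def inner_vec3 vector_3 using stereo_q_eq[of z] by algebra+

lemma stereo_y_inner:
  "stereo_y z \<bullet> stereo z = 0" "stereo_y z \<bullet> stereo_y z = 4 * (stereo_q z)\<^sup>2"
  unfolding stereo_defs Let_def inner_vec3 vector_3 using stereo_q_eq[of z] by algebra+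

lemma has_derivative_stereo_q:
  "(stereo_q has_derivative (\<lambda>h. - 2 * (Re z * Re h + Im z * Im h) * (stereo_q z)\<^sup>2)) (at z)"
proof -
  have "1 + (Re z)\<^sup>2 + (Im z)\<^sup>2 \<noteq> 0"
    by (metis add_pos_nonneg less_irrefl zero_le_power2 zero_less_one)
  then show ?thesis
    unfolding stereo_q_def
    by (auto intro!: derivative_eq_intros simp: fun_eq_iff algebra_simps power2_eq_square)
qed

lemma has_derivative_vector_3:
  assumes "(a has_derivative a') F" "(b has_derivative b') F" "(c has_derivative c') F"
  shows "((\<lambda>z. vector [a z, b z, c z] :: real^3) has_derivative (\<lambda>h. vector [a' h, b' h, c' h])) F"
proof -
  have eq: "(vector [r, s, t] :: real^3) = r *\<^sub>R axis 1 1 + s *\<^sub>R axis 2 1 + t *\<^sub>R axis 3 1" for r s t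
    by (simp add: vec_eq_iff forall_3 axis_def)
  show ?thesis
    unfolding eq using assms by (auto intro!: derivative_eq_intros)
qed

lemma has_derivative_stereo:
  "(stereo has_derivative (\<lambda>h. Re h *\<^sub>R stereo_x z + Im h *\<^sub>R stereo_y z)) (at z)"
  "(stereo_x has_derivative (\<lambda>h. Re h *\<^sub>R stereo_xx z + Im h *\<^sub>R stereo_xy z)) (at z)"
  "(stereo_y has_derivative (\<lambda>h. Re h *\<^sub>R stereo_xy z + Im h *\<^sub>R stereo_yy z)) (at z)"
  unfolding stereo_defs Let_def
  by (rule has_derivative_eq_rhs[OF has_derivative_vector_3],
      (rule derivative_eq_intros has_derivative_stereo_q refl)+,
      simp add: fun_eq_iff vec_eq_iff forall_3,
      simp add: algebra_simps power2_eq_square power3_eq_cube)+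

lemma stereo_surj:
  fixes x :: "real^3"
  assumes x: "x \<in> S2" and "x $ 3 \<noteq> 1"
  obtains z where "stereo z = x"
proof
  let ?z = "Complex (x$1 / (1 - x$3)) (x$2 / (1 - x$3))"
  have n: "(x$1)^2 + (x$2)^2 + (x$3)^2 = 1"
    using x by (simp add: norm_eq_1 inner_vec3 power2_eq_square)
  have "1 + (x$1 / (1 - x$3))^2 + (x$2 / (1 - x$3))^2 = 2 / (1 - x$3)"
    using n assms(2) by (simp add: field_simps) algebra
  then have q: "stereo_q ?z = (1 - x$3) / 2" by (simp add: stereo_q_def)
  show "stereo ?z = x"
    using assms(2) by (simp add: vec_eq_iff forall_3 stereo_def q) (simp add: field_simps)
qed

lemma continuous_on_stereo:
  "continuous_on S stereo" "continuous_on S stereo_x" "continuous_on S stereo_y"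
  using has_derivative_stereo[THEN has_derivative_continuous]
  by (auto intro!: continuous_at_imp_continuous_on)

lemma tendsto_stereo_q: "(stereo_q \<longlongrightarrow> 0) at_infinity"
proof -
  have "filterlim (\<lambda>z::complex. 1 + (norm z)\<^sup>2) at_top at_infinity"
    by (intro filterlim_tendsto_add_at_top[OF tendsto_const] filterlim_pow_at_top
        filterlim_norm_at_top) auto
  then have "((\<lambda>z::complex. inverse (1 + (norm z)\<^sup>2)) \<longlongrightarrow> 0) at_infinity"
    by (rule tendsto_inverse_0_at_top)
  moreover have "stereo_q = (\<lambda>z. inverse (1 + (norm z)\<^sup>2))"
    by (simp add: fun_eq_iff stereo_q_def cmod_power2 add.assoc)
  ultimately show ?thesis by simp
qed

section \<open>Divergence and curl in the stereographic coordinate\<close>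

lemma has_derivative_comp_stereo:
  assumes v: "C1_on_sphere v"
  shows "((\<lambda>z. v (stereo z)) has_derivative
    (\<lambda>h. Re h *\<^sub>R sphere_deriv v (stereo z) (stereo_x z) +
      Im h *\<^sub>R sphere_deriv v (stereo z) (stereo_y z))) (at z)"
proof -
  note d = C1_on_sphere_differentiable[OF v stereo_in_S2]
  have n: "norm (stereo z) = 1" for z using stereo_in_S2[of z] by simp
  show ?thesis
    using has_derivative_compose[OF has_derivative_stereo(1)
        has_derivative_extension_S2[OF stereo_in_S2 d], of z]
      linear_sphere_deriv[OF stereo_in_S2 d, of z]
    by (simp add: n linear_add linear_cmul)
qed

lemma tan_proj_inner: "tan_proj x a \<bullet> b = a \<bullet> tan_proj x b"
  by (simp add: tan_proj_def inner_diff_left inner_diff_right inner_commute)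

text \<open>The trace is computed in the frame of \<open>stereo_frame\<close>; the factor is the
  squared length of the frame vectors.\<close>

lemma sphere_div_stereo:
  assumes v: "C1_on_sphere v"
  shows "sphere_deriv v (stereo z) (stereo_x z) \<bullet> stereo_x z +
    sphere_deriv v (stereo z) (stereo_y z) \<bullet> stereo_y z =
    4 * (stereo_q z)\<^sup>2 * sphere_div v (stereo z)"
proof -
  let ?x = "stereo z" and ?sx = "stereo_x z" and ?sy = "stereo_y z"
  let ?D = "sphere_deriv v ?x"
  note d = C1_on_sphere_differentiable[OF v stereo_in_S2]
  note lin = linear_sphere_deriv[OF stereo_in_S2 d]
  have tr: "?D w \<bullet> w = (\<Sum>b\<in>Basis. (b \<bullet> w) * (?D b \<bullet> w))" for w
    by (subst linear_expand[OF lin]) (simp add: inner_sum_left inner_commute[of w])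
  have "?D ?sx \<bullet> ?sx + ?D ?sy \<bullet> ?sy =
      (\<Sum>b\<in>Basis. ?D b \<bullet> ((b \<bullet> ?sx) *\<^sub>R ?sx + (b \<bullet> ?sy) *\<^sub>R ?sy))"
    by (simp add: tr inner_add_right sum.distrib)
  also have "\<dots> = 4 * (stereo_q z)\<^sup>2 * (\<Sum>b\<in>Basis. ?D b \<bullet> tan_proj ?x b)"
    by (simp add: stereo_frame sum_distrib_left)
  also have "(\<Sum>b\<in>Basis. ?D b \<bullet> tan_proj ?x b) = sphere_div v ?x"
    by (simp add: sphere_div_def cov_deriv_def sphere_deriv_tan_proj[OF stereo_in_S2 d]
        tan_proj_inner)
  finally show ?thesis .
qed

text \<open>By \<open>sym\<close>, \<open>v x\<close> lies in the kernel of the antisymmetric part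
  of the derivative on the tangent plane. In dimension two an antisymmetric form with a nonzero
  kernel vector is zero, which settles the points where \<open>v\<close> does not vanish.\<close>

lemma curl_free_stereo:
  assumes tan: "tangent_field v" and v: "C1_on_sphere v"
    and sym: "\<And>x w. x \<in> S2 \<Longrightarrow> w \<bullet> x = 0 \<Longrightarrow>
      sphere_deriv v x (v x) \<bullet> w = sphere_deriv v x w \<bullet> v x"
  shows "sphere_deriv v (stereo z) (stereo_x z) \<bullet> stereo_y z =
    sphere_deriv v (stereo z) (stereo_y z) \<bullet> stereo_x z"
proof -
  define c where "c z = sphere_deriv v (stereo z) (stereo_x z) \<bullet> stereo_y z -
    sphere_deriv v (stereo z) (stereo_y z) \<bullet> stereo_x z" for z
  have nz: "c z = 0" if nz: "v (stereo z) \<noteq> 0" for z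
  proof -
    let ?x = "stereo z" and ?sx = "stereo_x z" and ?sy = "stereo_y z" and ?k = "4 * (stereo_q z)\<^sup>2"
    let ?D = "sphere_deriv v ?x"
    note lin = linear_sphere_deriv[OF stereo_in_S2 C1_on_sphere_differentiable[OF v stereo_in_S2]]
    define a b where "a = v ?x \<bullet> ?sx" and "b = v ?x \<bullet> ?sy"
    have k: "?k \<noteq> 0" using stereo_q_pos[of z] by simp
    have "v ?x \<bullet> ?x = 0" using tan stereo_in_S2 by (simp add: tangent_field_def)
    then have kv: "?k *\<^sub>R v ?x = a *\<^sub>R ?sx + b *\<^sub>R ?sy"
      using stereo_frame[of "v ?x" z] by (simp add: a_def b_def tan_proj_def)
    have "?D (?k *\<^sub>R v ?x) \<bullet> w = ?D w \<bullet> (?k *\<^sub>R v ?x)" if "w \<bullet> ?x = 0" for w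
      using sym[OF stereo_in_S2 that] by (simp add: linear_cmul[OF lin])
    then have "a * (?D ?sx \<bullet> w) + b * (?D ?sy \<bullet> w) = a * (?D w \<bullet> ?sx) + b * (?D w \<bullet> ?sy)"
      if "w \<bullet> ?x = 0" for w
      using that unfolding kv
      by (simp add: linear_add[OF lin] linear_cmul[OF lin] inner_add_left inner_add_right)
    \<comment> \<open>Here \<open>a\<close> and \<open>b\<close> are, up to a common factor, the
      coordinates of \<open>v\<close> in the frame; testing with each frame vector isolates one of
      them.\<close>
    from this[OF stereo_x_inner(1)] this[OF stereo_y_inner(1)]
    have "a * c z = 0" "b * c z = 0" by (auto simp: c_def algebra_simps)
    moreover have "a \<noteq> 0 \<or> b \<noteq> 0" using kv k nz by auto
    ultimately show ?thesis by auto
  qed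
  have "c z = 0"
  proof (rule ccontr)
    assume "c z \<noteq> 0"
    \<comment> \<open>By continuity \<open>c\<close> is nonzero on a neighbourhood of
      \<open>z\<close>, where \<open>v\<close> must vanish by \<open>nz\<close>; then the
      derivatives of \<open>v\<close> at \<open>z\<close>, and with them \<open>c z\<close>, vanish
      too.\<close>
    have "continuous_on UNIV c"
      unfolding c_def using stereo_in_S2
      by (intro continuous_intros continuous_on_sphere_deriv[OF v] continuous_on_stereo) auto
    then have "open (c -` (- {0}))"
      by (intro open_vimage) (auto simp: open_Compl)
    moreover have "v (stereo y) = 0" if "y \<in> c -` (- {0})" for y using nz that by auto
    moreover have "z \<in> c -` (- {0})" using \<open>c z \<noteq> 0\<close> by simp
    ultimately have "((\<lambda>z. v (stereo z)) has_derivative (\<lambda>_. 0)) (at z)"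
      by (intro has_derivative_transform_within_open[OF has_derivative_const[of 0]]) auto
    from has_derivative_unique[OF has_derivative_comp_stereo[OF v] this]
    have "Re h *\<^sub>R sphere_deriv v (stereo z) (stereo_x z) +
      Im h *\<^sub>R sphere_deriv v (stereo z) (stereo_y z) = 0" for h by metis
    from this[of 1] this[of \<i>] have "c z = 0" by (simp add: c_def)
    with \<open>c z \<noteq> 0\<close> show False by simp
  qed
  then show ?thesis by (simp add: c_def)
qed

text \<open>\<open>F\<close> is \<open>P - i Q\<close>, where \<open>P dx + Q dy\<close> is the
  pullback by \<open>stereo\<close> of the one-form dual to \<open>v\<close>. In dimension two,
  being closed and coclosed is conformally invariant.\<close>

lemma harmonic_field_eq_0:
  assumes tan: "tangent_field v" and v: "C1_on_sphere v"
    and div: "\<And>x. x \<in> S2 \<Longrightarrow> sphere_div v x = 0"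
    and curl: "\<And>z. sphere_deriv v (stereo z) (stereo_x z) \<bullet> stereo_y z =
      sphere_deriv v (stereo z) (stereo_y z) \<bullet> stereo_x z"
    and x: "x \<in> S2"
  shows "v x = 0"
proof -
  define F where "F z = of_real (v (stereo z) \<bullet> stereo_x z) - \<i> * of_real (v (stereo z) \<bullet> stereo_y z)"
    for z
  have tan': "v (stereo z) \<bullet> stereo z = 0" for z
    using tan stereo_in_S2 by (simp add: tangent_field_def)
  have "\<exists>d. (F has_field_derivative d) (at z)" for z
  proof -
    let ?D = "sphere_deriv v (stereo z)"
    define Px Qx Py Qy where "Px = ?D (stereo_x z) \<bullet> stereo_x z + v (stereo z) \<bullet> stereo_xx z"
      and "Qx = ?D (stereo_x z) \<bullet> stereo_y z + v (stereo z) \<bullet> stereo_xy z"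
      and "Py = ?D (stereo_y z) \<bullet> stereo_x z + v (stereo z) \<bullet> stereo_xy z"
      and "Qy = ?D (stereo_y z) \<bullet> stereo_y z + v (stereo z) \<bullet> stereo_yy z"
    note dv = has_derivative_comp_stereo[OF v, of z]
    have "((\<lambda>z. v (stereo z) \<bullet> stereo_x z) has_derivative (\<lambda>h. Re h * Px + Im h * Py)) (at z)"
      "((\<lambda>z. v (stereo z) \<bullet> stereo_y z) has_derivative (\<lambda>h. Re h * Qx + Im h * Qy)) (at z)"
      unfolding Px_def Py_def Qx_def Qy_def
      by (rule has_derivative_eq_rhs[OF has_derivative_inner[OF dv has_derivative_stereo(2)]]
            has_derivative_eq_rhs[OF has_derivative_inner[OF dv has_derivative_stereo(3)]],
          simp add: fun_eq_iff inner_add_left inner_add_right algebra_simps)+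
    then have dF: "(F has_derivative (\<lambda>h. of_real (Re h * Px + Im h * Py) -
        \<i> * of_real (Re h * Qx + Im h * Qy))) (at z)"
      unfolding F_def
      by (intro has_derivative_diff has_derivative_of_real has_derivative_mult_right)
    \<comment> \<open>The Cauchy--Riemann equations for \<open>F\<close> are \<open>curl v = 0\<close> and \<open>div v = 0\<close>.\<close>
    have "Py = Qx" using curl by (simp add: Py_def Qx_def)
    moreover have "Qy = - Px"
    proof -
      \<comment> \<open>The second-order terms of \<open>Px + Qy\<close> drop out since the
        Laplacian of the chart is normal and \<open>v\<close> is tangent.\<close>
      have "v (stereo z) \<bullet> (stereo_xx z + stereo_yy z) = 0"
        by (simp add: stereo_laplacian tan')
      then show ?thesis
        using sphere_div_stereo[OF v, of z] div[OF stereo_in_S2]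
        by (simp add: Px_def Qy_def inner_add_right)
    qed
    ultimately have "of_real (Re h * Px + Im h * Py) - \<i> * of_real (Re h * Qx + Im h * Qy) =
        Complex Px (- Qx) * h" for h
      by (simp add: complex_eq_iff algebra_simps)
    then have "(F has_field_derivative Complex Px (- Qx)) (at z)"
      using dF by (simp add: has_field_derivative_def)
    then show ?thesis ..
  qed
  then have "F holomorphic_on UNIV"
    by (auto simp: holomorphic_on_def field_differentiable_def)
  moreover have "(F \<longlongrightarrow> 0) at_infinity"
  proof -
    \<comment> \<open>Decay comes from the chart alone: \<open>v\<close> is bounded and the frame
      vectors shrink like \<open>stereo_q\<close> towards the pole.\<close>
    have "bounded (v ` S2)"
      by (intro compact_imp_bounded compact_continuous_image C1_on_sphere_continuous v) auto
    then obtain M where M: "\<And>x. x \<in> S2 \<Longrightarrow> norm (v x) \<le> M"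
      unfolding bounded_iff by blast
    have n: "norm (stereo_x z) = 2 * stereo_q z" "norm (stereo_y z) = 2 * stereo_q z" for z
      using stereo_q_pos[of z] by (auto simp: norm_eq_sqrt_inner stereo_x_inner stereo_y_inner real_sqrt_mult)
    have "norm (F z) \<le> 4 * M * stereo_q z" for z
    proof -
      have "norm (F z) \<le> \<bar>v (stereo z) \<bullet> stereo_x z\<bar> + \<bar>v (stereo z) \<bullet> stereo_y z\<bar>"
        unfolding F_def by (rule order_trans[OF norm_triangle_ineq4]) (simp add: norm_mult)
      also have "\<dots> \<le> norm (v (stereo z)) * norm (stereo_x z) + norm (v (stereo z)) * norm (stereo_y z)"
        by (intro add_mono Cauchy_Schwarz_ineq2)
      also have "\<dots> = norm (v (stereo z)) * (4 * stereo_q z)" by (simp add: n)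
      also have "\<dots> \<le> M * (4 * stereo_q z)"
        using M[OF stereo_in_S2] stereo_q_pos[of z] by (intro mult_right_mono) auto
      finally show ?thesis by simp
    qed
    moreover have "((\<lambda>z. 4 * M * stereo_q z) \<longlongrightarrow> 0) at_infinity"
      by (rule tendsto_mult_right_zero[OF tendsto_stereo_q])
    ultimately show ?thesis by (intro Lim_null_comparison[of F "\<lambda>z. 4 * M * stereo_q z"]) auto
  qed
  ultimately have F0: "F z = 0" for z by (rule Liouville_weak_0)
  have "v (stereo z) = 0" for z
  proof -
    have "v (stereo z) \<bullet> stereo_x z = 0" "v (stereo z) \<bullet> stereo_y z = 0"
      using F0[of z] by (auto simp: F_def complex_eq_iff)
    then show ?thesis
      using stereo_frame[of "v (stereo z)" z] stereo_q_pos[of z] tan' by (simp add: tan_proj_def)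
  qed
  then have off_pole: "v y = 0" if "y \<in> S2" "y $ 3 \<noteq> 1" for y
    using stereo_surj[OF that] by metis
  show ?thesis
  proof (cases "x $ 3 = 1")
    case False
    then show ?thesis using off_pole x by blast
  next
    case True
    \<comment> \<open>The chart omits the pole. This great circle passes through it at
      \<open>t = 0\<close> and avoids it for small nonzero \<open>t\<close>, so continuity carries
      \<open>v = 0\<close> over.\<close>
    define g :: "real \<Rightarrow> real^3" where
      "g t = vector [sin t, 0, cos t]" for t
    have g: "g t \<in> S2" for t
      by (simp add: g_def norm_eq_1 inner_vec3 flip: power2_eq_square)
    have "(x $ 1)\<^sup>2 + (x $ 2)\<^sup>2 = 0"
      using x True by (simp add: norm_eq_1 inner_vec3 power2_eq_square)
    then have "g 0 = x"
      using True by (simp add: g_def vec_eq_iff forall_3 sum_power2_eq_zero_iff)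
    have "(g has_derivative (\<lambda>h. vector [cos t * h, 0, - sin t * h])) (at t)" for t
      unfolding g_def[abs_def]
      by (rule has_derivative_vector_3) (auto intro!: derivative_eq_intros)
    then have "continuous_on UNIV g"
      by (intro continuous_at_imp_continuous_on ballI) (rule has_derivative_continuous)
    moreover have "range g \<subseteq> S2" using g by blast
    ultimately have "continuous_on UNIV (\<lambda>t. v (g t))"
      by (rule continuous_on_compose2[OF C1_on_sphere_continuous[OF v]])
    then have "((\<lambda>t. v (g t)) \<longlongrightarrow> v (g 0)) (at 0)"
      by (simp add: continuous_on_def)
    moreover have "((\<lambda>t. v (g t)) \<longlongrightarrow> 0) (at 0)"
    proof (rule tendsto_eventually)
      have "v (g t) = 0" if "t \<noteq> 0" "\<bar>t\<bar> < 1" for t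
      proof -
        have "cos \<bar>t\<bar> < cos 0" using that pi_gt3 by (intro cos_monotone_0_pi) auto
        then show ?thesis using g by (intro off_pole) (auto simp: g_def)
      qed
      then show "\<forall>\<^sub>F t in at 0. v (g t) = 0"
        by (auto simp: eventually_at dist_real_def intro!: exI[of _ 1])
    qed
    ultimately have "v (g 0) = 0" by (rule LIM_unique)
    then show ?thesis using \<open>g 0 = x\<close> by simp
  qed
qed

section \<open>The stationary Euler system\<close>

theorem proposition2p1:
  fixes v :: "real^3 \<Rightarrow> real^3" and f p :: "real^3 \<Rightarrow> real"
  assumes "tangent_field v"
    and "C1_on_sphere v" and "C1_on_sphere f" and "C1_on_sphere p"
    and "\<forall>x\<in>S2. f x + sphere_div v x = 0"
    and "\<forall>x\<in>S2. v x \<bullet> sphere_grad f x = (norm (v x))\<^sup>2 + (f x)\<^sup>2 + 2 * p x"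
    and "\<forall>x\<in>S2. cov_deriv v x (v x) = - sphere_grad p x"
  shows "\<forall>x\<in>S2. v x = 0 \<and> f x = 0 \<and> p x = 0"
proof -
  note v = assms(2) and f = assms(3) and p = assms(4)
  have tan: "v x \<bullet> x = 0" if "x \<in> S2" for x
    using assms(1) that by (simp add: tangent_field_def)
  have div: "sphere_div v x = - f x" if "x \<in> S2" for x
    using assms(5) that by (simp add: eq_neg_iff_add_eq_0 add.commute)
  \<comment> \<open>Pairing with tangent vectors removes the projection in
    \<open>cov_deriv\<close>.\<close>
  have mom: "sphere_deriv v x (v x) \<bullet> w = - sphere_deriv p x w" if x: "x \<in> S2" and w: "w \<bullet> x = 0" for x w
  proof -
    have "w \<bullet> cov_deriv v x (v x) = - sphere_deriv p x w"
      using assms(7) x inner_sphere_grad[OF x C1_on_sphere_differentiable[OF p x]] by simp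
    then show ?thesis
      using w by (simp add: cov_deriv_def tan_proj_def inner_diff_right inner_commute)
  qed
  \<comment> \<open>Twice the Bernoulli function of the tangential flow.\<close>
  define H where "H x = v x \<bullet> v x + 2 * p x" for x
  define DH where "DH x w = 2 * (v x \<bullet> sphere_deriv v x w) + 2 * sphere_deriv p x w" for x w
  have DH: "(H has_derivative DH x) (at x within S2)" "DH x x = 0" if "x \<in> S2" for x
  proof -
    note d = C1_on_sphere_has_deriv[OF v that] C1_on_sphere_has_deriv[OF p that]
    show "(H has_derivative DH x) (at x within S2)"
      unfolding H_def DH_def using d
      by (auto intro!: derivative_eq_intros simp: fun_eq_iff inner_commute)
    show "DH x x = 0"
      using that by (simp add: DH_def C1_on_sphere_deriv_normal v p)
  qed
  have "continuous_on S2 (\<lambda>x. DH x w)" for w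
    unfolding DH_def
    by (intro continuous_intros C1_on_sphere_continuous C1_on_sphere_continuous_deriv v p)
  from C1_on_sphereI[OF DH this] have H: "C1_on_sphere H"
    and dH: "\<And>x. x \<in> S2 \<Longrightarrow> sphere_deriv H x = DH x" by auto
  have vH: "sphere_deriv H x (v x) = 0" if "x \<in> S2" for x
    using mom[OF that tan[OF that]] dH[OF that] by (simp add: DH_def inner_commute)
  have vf: "sphere_deriv f x (v x) = H x + (f x)\<^sup>2" if "x \<in> S2" for x
    using assms(6) that inner_sphere_grad[OF that C1_on_sphere_differentiable[OF f that], of "v x"]
    by (simp add: H_def dot_square_norm)
  \<comment> \<open>The summand \<open>f * sphere_div v = - f\<^sup>2\<close> cancels the square in
    the Riccati equation and leaves \<open>H\<close>.\<close>
  have divfv: "sphere_div (\<lambda>y. f y *\<^sub>R v y) x = H x + (f x)\<^sup>2 - (f x)\<^sup>2" if "x \<in> S2" for x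
    using vf[OF that] inner_sphere_grad[OF that C1_on_sphere_differentiable[OF f that], of "v x"]
    by (simp add: sphere_div_scaleR[OF that f v] div[OF that] power2_eq_square)
  have neg: "H x + (f x)\<^sup>2 \<le> 0" if "x \<in> S2" for x
    using transport_nonpos[OF f H that vH vf] .
  have H0: "H x = 0" if "x \<in> S2" for x
  proof -
    have "sphere_div (\<lambda>y. f y *\<^sub>R v y) x = 0"
    proof (rule sphere_div_nonpos_imp_zero[OF _ C1_on_sphere_scaleR[OF f v] _ that])
      show "tangent_field (\<lambda>y. f y *\<^sub>R v y)" using tan by (simp add: tangent_field_def)
      show "sphere_div (\<lambda>y. f y *\<^sub>R v y) y \<le> 0" if "y \<in> S2" for y
        using neg[OF that] zero_le_power2[of "f y"] divfv[OF that] by linarith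
    qed
    then show ?thesis using divfv[OF that] by simp
  qed
  have f0: "f x = 0" if "x \<in> S2" for x
    using neg[OF that] H0[OF that] by simp
  have DH0: "DH x w = 0" if "x \<in> S2" for x w
  proof -
    have "(H has_derivative (\<lambda>_. 0)) (at x within S2)"
      by (rule has_derivative_transform[OF that H0 has_derivative_const])
    then have "sphere_deriv H x = (\<lambda>_. 0)" by (rule sphere_deriv_eqI[OF that]) simp
    then have "DH x = (\<lambda>_. 0)" using dH[OF that] by simp
    then show ?thesis by simp
  qed
  \<comment> \<open>As \<open>H\<close> is identically zero, the differential of \<open>p\<close> is
    minus half that of \<open>v \<bullet> v\<close>; the momentum equation then becomes the symmetry
    that \<open>curl_free_stereo\<close> asks for.\<close>
  have sym: "sphere_deriv v x (v x) \<bullet> w = sphere_deriv v x w \<bullet> v x"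
    if "x \<in> S2" "w \<bullet> x = 0" for x w
  proof -
    have "v x \<bullet> sphere_deriv v x w + sphere_deriv p x w = 0"
      using DH0[OF that(1), of w] unfolding DH_def by linarith
    then show ?thesis using mom[OF that] by (simp add: inner_commute)
  qed
  have div0: "sphere_div v x = 0" if "x \<in> S2" for x
    using div f0 that by simp
  have v0: "v x = 0" if "x \<in> S2" for x
    by (rule harmonic_field_eq_0[OF assms(1) v div0 curl_free_stereo[OF assms(1) v sym] that])
  show ?thesis using v0 f0 H0 by (auto simp: H_def)
qed

end
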